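(* Let $B$ be a finite Blaschke product that is not a power of $z$, and let $\phi:\mathbb{R}_+\to\mathbb{R}_+$ be an Orlicz function. (1) If $\phi(t)\asymp t^2$ as $t\to0$, then $\|B^k\|_{\ell^{\phi}}\asymp1$ with constants independent of $k\in\mathbb{N}$, i.e. there exist constants $c,C>0$ such that $c\le\|B^k\|_{\ell^{\phi}}\le C$ for all $k\in\mathbb{N}$; moreover $\|B^k\|_{\ell^{\phi}}=1$ for all $k\in\mathbb{N}$ when $\phi(t)=t^2$. (2) If $\phi(t)=o(t^2)$ as $t\to0$, then $\|B^k\|_{\ell^{\phi}}\to0$ as $k\to\infty$. (3) If $t^2=o(\phi(t))$ as $t\to0$, then $\|B^k\|_{\ell^{\phi}}\to\infty$ as $k\to\infty$.
   Context: $\mathbb{D}=\{z\in\mathbb{C}:|z|<1\}$. Given a finite family $\lambda_1,\dots,\lambda_m\in\mathbb{D}$ (repetitions allowed), the associated finite Blaschke product is $B(z)=\prod_{j=1}^m b_{\lambda_j}(z)$, where $b_{\lambda}(z)=\frac{\lambda}{|\lambda|}\frac{\lambda-z}{1-\bar\lambda z}$ for $\lambda\ne0$ and $b_0(z)=z$. "Power of $z$" means a function $z\mapsto z^n$ with $n\ge0$ an integer. $B^k$ denotes the $k$-th pointwise power of $B$. An Orlicz function is an increasing convex function $\phi:\mathbb{R}_+\to\mathbb{R}_+$ with $\phi(0)=0$, where $\mathbb{R}_+=[0,\infty)$. For $f$ analytic in $\mathbb{D}$, $\hat f(k)$, $k\ge 0$, denotes its $k$-th Fourier (i.e. Taylor)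 coefficient, so $f(z)=\sum_{k\ge0}\hat f(k)z^k$. The Orlicz space $\ell_a^{\phi}$ is the set of all $f$ analytic in $\mathbb{D}$ with $\sum_k\phi(|\hat f(k)|/\lambda)<+\infty$ for some $\lambda>0$, endowed with the Luxemburg norm $$\|f\|_{\ell^{\phi}}:=\inf\Big\{\lambda>0:\ \sum_k\phi\Big(\frac{|\hat f(k)|}{\lambda}\Big)\le1\Big\},$$ with $\|f\|_{\ell^\phi}=+\infty$ if no such $\lambda$ exists. For positive functions $f,g$, $f\asymp g$ as $t\to0$ means that there exist constants $c,C>0$ and $t_0\in(0,1)$ such that $cf(t)\le g(t)\le Cf(t)$ for all $t\in(0,t_0)$. *)

theory Defs
  imports "HOL-Complex_Analysis.Complex_Analysis" "HOL-Library.Landau_Symbols"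
begin

definition blaschke_factor :: "complex \<Rightarrow> complex \<Rightarrow> complex" where
  "blaschke_factor a z =
     (if a = 0 then z
      else a / of_real (cmod a) * ((a - z) / (1 - cnj a * z)))"

text \<open>Functions on the unit disc are represented by total functions on \<^typ>\<open>complex\<close>
  whose values outside \<^term>\<open>ball (0::complex) 1\<close> are irrelevant. The empty product
  (\<open>m = 0\<close>) is allowed; it is the zeroth power of \<open>z\<close>.\<close>

definition finite_blaschke_product :: "(complex \<Rightarrow> complex) \<Rightarrow> bool" where
  "finite_blaschke_product B \<longleftrightarrow>
     (\<exists>(m::nat) (a :: nat \<Rightarrow> complex).
        (\<forall>j\<in>{1..m}. a j \<in> ball 0 1) \<and>
        (\<forall>z\<in>ball 0 1. B z = (\<Prod>j=1..m. blaschke_factor (a j) z)))"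

definition power_of_z :: "(complex \<Rightarrow> complex) \<Rightarrow> bool" where
  "power_of_z f \<longleftrightarrow> (\<exists>n::nat. \<forall>z\<in>ball 0 1. f z = z ^ n)"

text \<open>``Increasing'' is read in the weak sense, so Orlicz functions vanishing near \<open>0\<close>
  are included. Values of \<open>\<phi>\<close> at negative arguments are irrelevant.\<close>

definition orlicz_function :: "(real \<Rightarrow> real) \<Rightarrow> bool" where
  "orlicz_function \<phi> \<longleftrightarrow>
     (\<forall>t\<ge>0. \<phi> t \<ge> 0) \<and> \<phi> 0 = 0 \<and> mono_on {0..} \<phi> \<and> convex_on {0..} \<phi>"

definition taylor_coeff :: "(complex \<Rightarrow> complex) \<Rightarrow> nat \<Rightarrow> complex" where
  "taylor_coeff f k = fps_nth (fps_expansion f 0) k"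

text \<open>The series is taken in \<^typ>\<open>ennreal\<close>, so a divergent series has value \<open>\<infinity>\<close>;
  the infimum of the empty set is \<open>\<infinity>\<close> as well.\<close>

definition orlicz_norm :: "(real \<Rightarrow> real) \<Rightarrow> (complex \<Rightarrow> complex) \<Rightarrow> ennreal" where
  "orlicz_norm \<phi> f =
     Inf {ennreal r | r::real. r > 0 \<and>
        (\<Sum>k. ennreal (\<phi> (cmod (taylor_coeff f k) / r))) \<le> 1}"

definition asymp_at_zero :: "(real \<Rightarrow> real) \<Rightarrow> (real \<Rightarrow> real) \<Rightarrow> bool" where
  "asymp_at_zero f g \<longleftrightarrow>
     (\<exists>c>0. \<exists>C>0. \<exists>t0\<in>{0<..<1}. \<forall>t\<in>{0<..<t0}. c * f t \<le> g t \<and> g t \<le> C * f t)"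

end

theory Submission
  imports Defs
begin

text \<open>A finite Blaschke product has modulus one on the unit circle, so by Parseval the squares of the
moduli of the Taylor coefficients of \<open>B ^ k\<close> sum to \<open>1\<close> for every \<open>k\<close>. The \<open>\<ell>\<^sup>2\<close> mass is thus fixed,
and the size of the Orlicz norm is decided by how this mass is spread.

The mass spreads out completely: the supremum over \<open>n\<close> of the moduli of the \<open>n\<close>-th coefficients of
\<open>B ^ k\<close> tends to \<open>0\<close> as \<open>k\<close> grows (\<open>blaschke_power_coeffs_uniformly_small\<close>). Hence for large \<open>k\<close>
only the values of \<open>\<phi>\<close> near \<open>0\<close> matter, and a comparison of \<open>\<phi>\<close> with \<open>\<epsilon> * t\<^sup>2\<close> or with \<open>t\<^sup>2 / \<epsilon>\<close> there
gives the limits \<open>0\<close> and \<open>\<infinity>\<close>. If \<open>\<phi>\<close> is comparable to \<open>t\<^sup>2\<close>, the bound \<open>1\<close> on all coefficients and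
convexity suffice to compare the norm with a constant for every \<open>k\<close>.

For the decay of the coefficients, write the \<open>n\<close>-th coefficient of \<open>B ^ k\<close> as the mean over the circle
of \<open>f t = B (cis t) ^ k * cis (- n * t)\<close>. The argument of \<open>B (cis t)\<close> has derivative
\<open>p t = (\<Sum>j. (1 - \<bar>a j\<bar>\<^sup>2) / \<bar>cis t - a j\<bar>\<^sup>2)\<close>, so \<open>f\<close> oscillates with speed \<open>k * (p t - n / k)\<close>. Integration by
parts against the regularised reciprocal \<open>(p - \<theta>) / ((p - \<theta>)\<^sup>2 + \<epsilon>)\<close>, where \<open>\<theta> = n / k\<close>, bounds the
integral by \<open>O(1 / (k * \<epsilon>))\<close> plus the integral of \<open>\<epsilon> / ((p - \<theta>)\<^sup>2 + \<epsilon>)\<close>. The latter tends to \<open>0\<close> with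
\<open>\<epsilon>\<close>, uniformly in \<open>\<theta>\<close>, as soon as the level sets of \<open>p\<close> are finite. They are, because
\<open>p\<close> is the restriction to the circle of a rational function, which is constant only when all zeros of
\<open>B\<close> lie at the origin, that is, when \<open>B\<close> is a power of \<open>z\<close>.\<close>

section \<open>Taylor coefficients as Fourier coefficients\<close>

lemma taylor_coeff_eq_circle_integral:
  assumes f: "f holomorphic_on ball 0 R" and "R > 1"
  shows "((\<lambda>t. f (cis t) * cis (- (real n * t))) has_integral 2 * pi * taylor_coeff f n) {0..2*pi}"
proof -
  have sub: "cball 0 1 \<subseteq> ball (0::complex) R" "ball 0 1 \<subseteq> ball (0::complex) R" 
    using \<open>R > 1\<close> by auto
  have "((\<lambda>u. f u / (u - 0) ^ (Suc n)) has_contour_integral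
      ((2 * pi * \<i>) / (fact n) * (deriv ^^ n) f 0)) (circlepath 0 1)"
    by (rule Cauchy_has_contour_integral_higher_derivative_circlepath)
       (use sub in \<open>auto intro!: holomorphic_on_imp_continuous_on holomorphic_on_subset[OF f]\<close>)
  hence "((\<lambda>t. f (cis t) / cis t ^ Suc n * \<i> * cis t)
      has_integral ((2 * pi * \<i>) * taylor_coeff f n)) {0..2*pi}"
    unfolding circlepath_def
    by (subst (asm) has_contour_integral_part_circlepath_iff)
       (auto simp: taylor_coeff_def fps_expansion_def)
  hence "((\<lambda>t. - \<i> * (f (cis t) / cis t ^ Suc n * \<i> * cis t))
      has_integral (- \<i> * ((2 * pi * \<i>) * taylor_coeff f n))) {0..2*pi}"
    by (rule has_integral_mult_right)
  moreover have "(\<lambda>t. - \<i> * (f (cis t) / cis t ^ Suc n * \<i> * cis t)) = (\<lambda>t. f (cis t) * cis (- (real n * t)))"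
  proof
    fix t
    have "cis (- (real n * t)) = inverse (cis t ^ n)"
      by (simp add: Complex.DeMoivre)
    moreover have "- \<i> * (x / z ^ Suc n * \<i> * z) = x * inverse (z ^ n)" if "z \<noteq> 0" for x z :: complex
      using that by (simp add: field_simps)
    ultimately show "- \<i> * (f (cis t) / cis t ^ Suc n * \<i> * cis t) = f (cis t) * cis (- (real n * t))"
      by (simp only: cis_neq_zero not_False_eq_True)
  qed
  moreover have "- \<i> * ((2 * pi * \<i>) * taylor_coeff f n) = 2 * pi * taylor_coeff f n"
    by (simp add: algebra_simps)
  ultimately show ?thesis by (simp only:)
qed

lemma parseval_circle:
  assumes f: "f holomorphic_on ball 0 R" and "R > 1"
  shows "(\<lambda>n. (cmod (taylor_coeff f n))\<^sup>2) sums
           (integral {0..2*pi} (\<lambda>t. (cmod (f (cis t)))\<^sup>2) / (2 * pi))"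
proof -
  define c where "c = taylor_coeff f"
  have f': "f holomorphic_on eball 0 (ereal R)"
    using f by simp
  have cf: "continuous_on {0..2*pi} (\<lambda>t. f (cis t))"
    using \<open>R > 1\<close> by (intro continuous_on_compose2[OF holomorphic_on_imp_continuous_on[OF f]] continuous_intros) auto
  obtain K where K: "\<And>t. t \<in> {0..2*pi} \<Longrightarrow> cmod (f (cis t)) \<le> K"
    using compact_imp_bounded[OF compact_continuous_image[OF cf compact_Icc]] 
    unfolding bounded_iff by blast
  have rad: "ereal 1 < fps_conv_radius (fps_expansion f 0)"
    using conv_radius_fps_expansion[OF f'] \<open>R > 1\<close> less_le_trans[of "ereal 1" "ereal R"] by simp
  have "summable (\<lambda>n. norm (fps_nth (fps_expansion f 0) n * 1 ^ n))"
    by (rule abs_summable_in_conv_radius) (use rad in \<open>simp add: fps_conv_radius_def\<close>)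
  hence abs: "summable (\<lambda>n. cmod (c n))"
    by (simp add: c_def taylor_coeff_def[abs_def])
  have expand: "(\<lambda>n. c n * cis t ^ n) sums f (cis t)" for t
  proof -
    have "(\<lambda>n. c n * cis t ^ n) sums eval_fps (fps_expansion f 0) (cis t)"
      unfolding c_def taylor_coeff_def using rad by (intro sums_eval_fps) (simp add: one_ereal_def)
    also have "eval_fps (fps_expansion f 0) (cis t) = f (cis t)"
      using eval_fps_expansion'[OF f', of "cis t"] \<open>R > 1\<close> by simp
    finally show ?thesis .
  qed
  \<comment> \<open>Multiplying the absolutely convergent expansion of \<open>f\<close> by the bounded function \<open>cnj f\<close>
      keeps it uniformly convergent, so it can be integrated term by term; each term is again
      an integral for a Taylor coefficient.\<close>
  define g where "g = (\<lambda>n t. c n * cis t ^ n * cnj (f (cis t)))"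
  have sum_g: "(\<Sum>n. g n t) = of_real ((cmod (f (cis t)))\<^sup>2)" for t
    using sums_mult2[OF expand[of t], of "cnj (f (cis t))"]
    by (simp add: g_def sums_iff complex_norm_square del: of_real_power)
  have int_g: "(g n has_integral of_real (2 * pi * (cmod (c n))\<^sup>2)) {0..2*pi}" for n
  proof -
    have "((\<lambda>t. c n * cnj (f (cis t) * cis (- (real n * t)))) has_integral 
        c n * cnj (2 * pi * c n)) {0..2*pi}"
      using taylor_coeff_eq_circle_integral[OF assms, of n] unfolding c_def
      by (intro has_integral_mult_right has_integral_cnj[THEN iffD2, unfolded o_def])
    moreover have "(\<lambda>t. c n * cnj (f (cis t) * cis (- (real n * t)))) = g n"
      by (simp add: g_def cis_cnj Complex.DeMoivre fun_eq_iff)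
    moreover have "c n * cnj (2 * pi * c n) = of_real (2 * pi * (cmod (c n))\<^sup>2)"
      by (simp add: complex_norm_square del: of_real_power)
    ultimately show ?thesis by (simp only:)
  qed
  have "uniform_limit {0..2*pi} (\<lambda>N t. \<Sum>n<N. g n t) (\<lambda>t. \<Sum>n. g n t) sequentially"
    by (rule Weierstrass_m_test[where M = "\<lambda>n. cmod (c n) * K"])
       (auto simp: g_def norm_mult norm_power intro!: mult_left_mono K summable_mult2 abs)
  moreover have "continuous_on {0..2*pi} (\<lambda>t. \<Sum>n<N. g n t)" for N
    unfolding g_def by (intro continuous_intros cf)
  ultimately obtain I J where IJ: "\<And>N. ((\<lambda>t. \<Sum>n<N. g n t) has_integral I N) {0..2*pi}"
      "((\<lambda>t. \<Sum>n. g n t) has_integral J) {0..2*pi}" "I \<longlonglongrightarrow> J"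
    by (rule uniform_limit_integral) auto
  have "I = (\<lambda>N. \<Sum>n<N. of_real (2 * pi * (cmod (c n))\<^sup>2))"
    by (rule ext, rule has_integral_unique[OF IJ(1)]) (intro has_integral_sum int_g finite_lessThan)
  with IJ(3) have "(\<lambda>n. of_real (2 * pi * (cmod (c n))\<^sup>2)) sums J"
    by (simp only: sums_def)
  from sums_Re[OF this] have "(\<lambda>n. 2 * pi * (cmod (c n))\<^sup>2) sums Re J"
    by simp
  moreover have "Re J = integral {0..2*pi} (\<lambda>t. (cmod (f (cis t)))\<^sup>2)"
  proof -
    have "((\<lambda>t. Re (\<Sum>n. g n t)) has_integral Re J) {0..2*pi}"
      by (rule has_integral_Re[OF IJ(2)])
    thus ?thesis unfolding sum_g by (simp add: integral_unique)
  qed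
  ultimately show ?thesis
    using sums_divide[of "\<lambda>n. 2 * pi * (cmod (c n))\<^sup>2" "Re J" "2*pi"] by (simp add: c_def)
qed

section \<open>Oscillatory integrals\<close>

text \<open>Integration by parts for \<open>f\<close> with phase speed \<open>\<kappa> * (p - \<theta>)\<close>. Dividing by the speed is impossible where it
vanishes; replacing \<open>1 / (p - \<theta>)\<close> by \<open>(p - \<theta>) / ((p - \<theta>)\<^sup>2 + \<epsilon>)\<close> makes the derivative of the weight at most
\<open>M / \<epsilon>\<close> and costs the second summand. The first summand does not involve \<open>\<theta>\<close>,
so a bound uniform in \<open>\<theta>\<close> only needs one for the second. Equal values at both ends remove the boundary terms.\<close>
lemma oscillatory_integral_bound:
  fixes p p' :: "real \<Rightarrow> real" and f :: "real \<Rightarrow> complex"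
  assumes "a \<le> b" "\<kappa> > 0" "\<epsilon> > 0"
    and dp: "\<And>t. t \<in> {a..b} \<Longrightarrow> (p has_real_derivative p' t) (at t)"
    and cp': "continuous_on {a..b} p'"
    and M: "\<And>t. t \<in> {a..b} \<Longrightarrow> \<bar>p' t\<bar> \<le> M"
    and df: "\<And>t. t \<in> {a..b} \<Longrightarrow>
               (f has_vector_derivative \<i> * of_real (\<kappa> * (p t - \<theta>)) * f t) (at t)"
    and nf: "\<And>t. t \<in> {a..b} \<Longrightarrow> cmod (f t) = 1"
    and per: "p b = p a" "f b = f a"
  shows "cmod (integral {a..b} f) \<le>
           M * (b - a) / (\<kappa> * \<epsilon>) + integral {a..b} (\<lambda>t. \<epsilon> / ((p t - \<theta>)\<^sup>2 + \<epsilon>))"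
proof -
  define q where "q = (\<lambda>t. p t - \<theta>)"
  define w where "w = (\<lambda>t. q t / ((q t)\<^sup>2 + \<epsilon>))"
  define w' where "w' = (\<lambda>t. p' t * (\<epsilon> - (q t)\<^sup>2) / ((q t)\<^sup>2 + \<epsilon>)\<^sup>2)"
  \<comment> \<open>\<open>w\<close> is a smooth substitute for \<open>1 / q\<close>, and \<open>v = 1 - q * w\<close> is the error made.\<close>
  define v where "v = (\<lambda>t. \<epsilon> / ((q t)\<^sup>2 + \<epsilon>))"
  have pos: "(q t)\<^sup>2 + \<epsilon> > 0" for t
    using \<open>\<epsilon> > 0\<close> by (simp add: add_nonneg_pos)
  hence nz: "(q t)\<^sup>2 + \<epsilon> \<noteq> 0" for t by (metis less_irrefl)
  have cq: "continuous_on {a..b} q" unfolding q_def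
    by (intro continuous_at_imp_continuous_on continuous_intros ballI DERIV_isCont[OF dp]) auto
  have cf: "continuous_on {a..b} f"
    by (intro continuous_at_imp_continuous_on ballI has_vector_derivative_continuous[OF df])
  have cw: "continuous_on {a..b} w" and cw': "continuous_on {a..b} w'" and cv: "continuous_on {a..b} v"
    unfolding w_def w'_def v_def
    by (intro continuous_on_divide continuous_on_mult continuous_on_diff continuous_on_add
         continuous_on_power continuous_on_const cq cp'; simp add: nz)+
  have dw: "(w has_real_derivative w' t) (at t)" if "t \<in> {a..b}" for t
  proof -
    have dq: "(q has_real_derivative p' t) (at t)"
      unfolding q_def using DERIV_diff[OF dp[OF that] DERIV_const[of \<theta>]] by simp
    have "((\<lambda>t. (q t)\<^sup>2 + \<epsilon>) has_real_derivative 2 * q t * p' t) (at t)"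
      using DERIV_add[OF DERIV_power[OF dq, of 2] DERIV_const[of \<epsilon>]] by (simp add: mult_ac)
    from DERIV_divide[OF dq this nz] 
    show ?thesis unfolding w_def w'_def by (simp add: power2_eq_square algebra_simps)
  qed
  have "((\<lambda>t. f t * of_real (w' t) + \<i> * of_real (\<kappa> * q t) * f t * of_real (w t)) has_integral
      f b * of_real (w b) - f a * of_real (w a)) {a..b}"
  proof (intro fundamental_theorem_of_calculus \<open>a \<le> b\<close>)
    fix t assume t: "t \<in> {a..b}"
    have "((\<lambda>t. f t * of_real (w t)) has_vector_derivative
        (f t * of_real (w' t) + \<i> * of_real (\<kappa> * q t) * f t * of_real (w t))) (at t)"
      using df[OF t] has_vector_derivative_of_real[OF dw[OF t]]
      by (intro has_vector_derivative_mult) (auto simp: q_def)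
    thus "((\<lambda>t. f t * of_real (w t)) has_vector_derivative
        (f t * of_real (w' t) + \<i> * of_real (\<kappa> * q t) * f t * of_real (w t))) (at t within {a..b})"
      by (rule has_vector_derivative_at_within)
  qed
  hence ibp: "((\<lambda>t. f t * of_real (w' t) + \<i> * of_real (\<kappa> * q t) * f t * of_real (w t)) has_integral 0) {a..b}"
    using per by (simp add: w_def q_def)
  have i1: "(\<lambda>t. f t * of_real (w' t)) integrable_on {a..b}"
    and i2: "(\<lambda>t. of_real (v t) * f t) integrable_on {a..b}"
    and i3: "v integrable_on {a..b}"
    by (intro integrable_continuous_real continuous_intros cf cw' cv)+
  \<comment> \<open>\<open>f = q * w * f + v * f\<close>, and \<open>\<kappa> * q * w * f\<close> is, up to a factor of modulus one, the integrand
      of \<open>ibp\<close> minus \<open>f * w'\<close>.\<close>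
  have dec: "f t = (\<i> / of_real \<kappa>) * (f t * of_real (w' t)
      - (f t * of_real (w' t) + \<i> * of_real (\<kappa> * q t) * f t * of_real (w t))) + of_real (v t) * f t" for t
  proof -
    have "q t * w t + v t = 1"
      using nz[of t] by (simp add: w_def v_def power2_eq_square flip: add_divide_distrib)
    hence "of_real (q t) * of_real (w t) + of_real (v t) = (1::complex)"
      by (metis of_real_1 of_real_add of_real_mult)
    hence "f t = (of_real (q t) * of_real (w t) + of_real (v t)) * f t" by simp
    thus ?thesis using \<open>\<kappa> > 0\<close> by (simp add: field_simps)
  qed
  have "(f has_integral (\<i> / of_real \<kappa>) * (integral {a..b} (\<lambda>t. f t * of_real (w' t)) - 0)
      + integral {a..b} (\<lambda>t. of_real (v t) * f t)) {a..b}"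
    by (subst dec[abs_def], intro has_integral_add has_integral_mult_right has_integral_diff ibp
         integrable_integral i1 i2)
  hence "cmod (integral {a..b} f) = cmod ((\<i> / of_real \<kappa>) * integral {a..b} (\<lambda>t. f t * of_real (w' t))
      + integral {a..b} (\<lambda>t. of_real (v t) * f t))"
    by (simp add: integral_unique)
  also have "\<dots> \<le> cmod (integral {a..b} (\<lambda>t. f t * of_real (w' t))) / \<kappa>
      + cmod (integral {a..b} (\<lambda>t. of_real (v t) * f t))"
    using \<open>\<kappa> > 0\<close> by (intro order.trans[OF norm_triangle_ineq]) (simp add: norm_mult norm_divide)
  also have "cmod (integral {a..b} (\<lambda>t. f t * of_real (w' t))) \<le> M / \<epsilon> * (b - a)"
  proof (intro integral_bound \<open>a \<le> b\<close> continuous_intros cf cw')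
    fix t assume t: "t \<in> {a..b}"
    have "\<bar>\<epsilon> - (q t)\<^sup>2\<bar> \<le> (q t)\<^sup>2 + \<epsilon>" using \<open>\<epsilon> > 0\<close> by (auto simp: abs_if)
    hence "\<bar>p' t\<bar> * \<bar>\<epsilon> - (q t)\<^sup>2\<bar> \<le> M * ((q t)\<^sup>2 + \<epsilon>)"
      using M[OF t] by (intro mult_mono) auto
    hence "\<bar>w' t\<bar> \<le> M * ((q t)\<^sup>2 + \<epsilon>) / ((q t)\<^sup>2 + \<epsilon>)\<^sup>2"
      by (simp add: w'_def abs_mult divide_right_mono)
    also have "\<dots> = M / ((q t)\<^sup>2 + \<epsilon>)" using nz[of t] by (simp add: power2_eq_square)
    also have "\<dots> \<le> M / \<epsilon>"
      using M[OF t] \<open>\<epsilon> > 0\<close> pos[of t] by (intro divide_left_mono) auto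
    finally show "cmod (f t * of_real (w' t)) \<le> M / \<epsilon>" using nf[OF t] by (simp add: norm_mult)
  qed
  also have "cmod (integral {a..b} (\<lambda>t. of_real (v t) * f t)) \<le> integral {a..b} v"
  proof (intro integral_norm_bound_integral i2 i3)
    fix t assume "t \<in> {a..b}"
    moreover have "v t \<ge> 0" using \<open>\<epsilon> > 0\<close> pos[of t] by (simp add: v_def)
    ultimately show "cmod (of_real (v t) * f t) \<le> v t" using nf by (simp add: norm_mult)
  qed
  finally show ?thesis using \<open>\<kappa> > 0\<close> 
    by (simp add: v_def q_def divide_right_mono field_simps)
qed

text \<open>The integrand is bounded by \<open>1\<close> and tends to \<open>0\<close> with \<open>\<epsilon>\<close> off the level set \<open>p = \<theta>\<close>, which is finite. If
uniformity in \<open>\<theta>\<close> failed, there would be levels \<open>\<theta>\<close> for \<open>\<epsilon> = 1, 1/2, 1/3, \<dots>\<close> with integrals above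
\<open>\<eta>\<close>; along a convergent subsequence of these levels dominated convergence gives a contradiction.\<close>
lemma uniformly_small_mass_near_levels:
  fixes p :: "real \<Rightarrow> real"
  assumes cp: "continuous_on {a..b} p"
    and levels: "\<And>c. finite {t \<in> {a..b}. p t = c}" and "\<eta> > 0"
  shows "\<exists>\<epsilon>>0. \<forall>\<theta>. integral {a..b} (\<lambda>t. \<epsilon> / ((p t - \<theta>)\<^sup>2 + \<epsilon>)) \<le> \<eta>"
proof (rule ccontr)
  assume contr: "\<not> ?thesis"
  define e where "e = (\<lambda>n. inverse (real (Suc n)))"
  have e: "e n > 0" for n by (simp add: e_def)
  have e0: "e \<longlonglongrightarrow> 0" unfolding e_def by (rule LIMSEQ_inverse_real_of_nat)
  define v where "v = (\<lambda>n \<theta> t. e n / ((p t - \<theta>)\<^sup>2 + e n))"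
  have pos: "(p t - \<theta>)\<^sup>2 + e n > 0" for t \<theta> n
    using e[of n] by (simp add: add_nonneg_pos)
  have iv: "v n \<theta> integrable_on {a..b}" for n \<theta>
    unfolding v_def using pos 
    by (intro integrable_continuous_real continuous_intros cp) (metis less_irrefl)
  obtain M where M: "\<And>t. t \<in> {a..b} \<Longrightarrow> \<bar>p t\<bar> \<le> M"
    using compact_imp_bounded[OF compact_continuous_image[OF cp compact_Icc]] 
    unfolding bounded_iff real_norm_def by blast
  have "\<exists>\<theta>. \<bar>\<theta>\<bar> \<le> \<bar>M\<bar> \<and> \<eta> < integral {a..b} (v n \<theta>)" for n
  proof -
    obtain \<theta> where \<theta>: "\<eta> < integral {a..b} (v n \<theta>)"
      using contr e[of n] unfolding v_def by (auto simp: not_le)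
    \<comment> \<open>Clamping \<open>\<theta>\<close> to an interval that contains the range of \<open>p\<close> moves it closer to every value
        of \<open>p\<close>, so the integral only grows and \<open>\<theta>\<close> may be taken from a compact set.\<close>
    define \<theta>' where "\<theta>' = max (- \<bar>M\<bar>) (min \<bar>M\<bar> \<theta>)"
    have "v n \<theta> t \<le> v n \<theta>' t" if "t \<in> {a..b}" for t
    proof -
      have "\<bar>p t - \<theta>'\<bar> \<le> \<bar>p t - \<theta>\<bar>"
        using M[OF that] by (auto simp: \<theta>'_def)
      hence "(p t - \<theta>')\<^sup>2 \<le> (p t - \<theta>)\<^sup>2" by (simp add: abs_le_square_iff)
      thus ?thesis unfolding v_def using e[of n] pos[of t _ n]
        by (intro divide_left_mono) (auto intro: mult_pos_pos)
    qed
    hence "integral {a..b} (v n \<theta>) \<le> integral {a..b} (v n \<theta>')"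
      by (intro integral_le iv)
    with \<theta> show ?thesis by (intro exI[of _ \<theta>']) (auto simp: \<theta>'_def abs_if max_def min_def)
  qed
  then obtain \<theta> where \<theta>: "\<And>n. \<theta> n \<in> {- \<bar>M\<bar>..\<bar>M\<bar>}" "\<And>n. \<eta> < integral {a..b} (v n (\<theta> n))"
    by (auto simp: abs_le_iff minus_le_iff) metis
  obtain l r where r: "strict_mono (r :: nat \<Rightarrow> nat)" and l: "(\<theta> \<circ> r) \<longlonglongrightarrow> l"
    using \<theta>(1) compact_Icc unfolding compact_eq_seq_compact_metric seq_compact_def by metis
  define Z where "Z = {t \<in> {a..b}. p t = l}"
  have Z: "negligible Z" unfolding Z_def by (intro negligible_finite levels)
  define S where "S = {a..b} - Z"
  have int_S: "integral S h = integral {a..b} h" for h :: "real \<Rightarrow> real"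
    by (rule integral_spike_set) (auto simp: S_def intro: negligible_subset[OF Z])
  have "(\<lambda>n. integral S (v (r n) (\<theta> (r n)))) \<longlonglongrightarrow> integral S (\<lambda>_. 0 :: real)"
  proof (rule dominated_convergence(2)[where h = "\<lambda>_. 1"])
    show "v (r n) (\<theta> (r n)) integrable_on S" for n
      by (rule integrable_spike_set[OF iv]) (auto simp: S_def intro: negligible_subset[OF Z])
    show "(\<lambda>_. 1 :: real) integrable_on S"
      by (rule integrable_spike_set[of _ "{a..b}"]) (auto simp: S_def intro: negligible_subset[OF Z])
    show "norm (v (r n) (\<theta> (r n)) t) \<le> 1" for n t
      using e[of "r n"] pos[of t "\<theta> (r n)" "r n"] by (simp add: v_def)
    show "(\<lambda>n. v (r n) (\<theta> (r n)) t) \<longlonglongrightarrow> 0" if "t \<in> S" for t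
    proof -
      have "(\<lambda>n. e (r n)) \<longlonglongrightarrow> 0" "(\<lambda>n. \<theta> (r n)) \<longlonglongrightarrow> l"
        using LIMSEQ_subseq_LIMSEQ[OF e0 r] l by (auto simp: o_def)
      hence "(\<lambda>n. v (r n) (\<theta> (r n)) t) \<longlonglongrightarrow> 0 / ((p t - l)\<^sup>2 + 0)"
        unfolding v_def using that by (intro tendsto_intros) (auto simp: S_def Z_def)
      thus ?thesis by simp
    qed
  qed
  hence "(\<lambda>n. integral {a..b} (v (r n) (\<theta> (r n)))) \<longlonglongrightarrow> 0"
    by (simp add: int_S)
  hence "\<eta> \<le> 0"
    by (rule LIMSEQ_le_const) (use \<theta>(2) in \<open>auto intro: less_imp_le\<close>)
  with \<open>\<eta> > 0\<close> show False by simp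
qed

section \<open>Blaschke factors on the unit circle\<close>

lemma disc_factor_nonzero:
  assumes "cmod a < 1" "cmod z \<le> 1"
  shows "1 - cnj a * z \<noteq> 0"
proof -
  have "cmod (cnj a * z) < 1" 
    using assms mult_left_le[of "cmod z" "cmod a"] by (simp add: norm_mult)
  thus ?thesis by (metis eq_iff_diff_eq_0 norm_one less_irrefl)
qed

lemma norm_blaschke_factor_circle:
  assumes "cmod a < 1" "cmod z = 1"
  shows "cmod (blaschke_factor a z) = 1"
proof (cases "a = 0")
  case False
  have zz: "z * cnj z = 1" using assms(2) complex_norm_square[of z] by simp
  have "a - z = - (z * cnj (1 - cnj a * z))" using zz by (simp add: algebra_simps)
  hence eq: "cmod (a - z) = cmod (1 - cnj a * z)"
    using assms(2) by (simp only: norm_minus_cancel norm_mult complex_mod_cnj mult_1)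
  have "1 - cnj a * z \<noteq> 0" using disc_factor_nonzero[of a z] assms by simp
  with False eq show ?thesis by (simp add: blaschke_factor_def norm_mult norm_divide)
qed (simp add: blaschke_factor_def assms)

text \<open>The logarithmic derivative \<open>z * b' z / b z\<close> of the Blaschke factor \<open>b\<close> with zero \<open>a\<close>. For \<open>a\<close> in the disc it is
real and positive on the circle, namely the derivative in \<open>t\<close> of the argument of \<open>b (cis t)\<close>; as a rational function it
also extends off the circle.\<close>
definition phase_speed :: "complex \<Rightarrow> complex \<Rightarrow> complex" where
  "phase_speed a z = of_real (1 - (cmod a)\<^sup>2) * z / ((z - a) * (1 - cnj a * z))"

lemma phase_speed_circle:
  assumes "cmod a < 1" "cmod z = 1"
  shows "phase_speed a z = of_real ((1 - (cmod a)\<^sup>2) / (cmod (z - a))\<^sup>2)"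
proof -
  have zz: "z * cnj z = 1" using assms(2) complex_norm_square[of z] by simp
  have "1 - cnj a * z = z * cnj (z - a)" using zz by (simp add: algebra_simps)
  hence "(z - a) * (1 - cnj a * z) = z * of_real ((cmod (z - a))\<^sup>2)"
    by (simp add: complex_norm_square del: of_real_power)
  moreover have "z \<noteq> 0" using assms by auto
  ultimately show ?thesis by (simp add: phase_speed_def)
qed

lemma phase_speed_analytic:
  assumes "cmod a < 1"
  shows "phase_speed a analytic_on sphere 0 1"
  unfolding phase_speed_def[abs_def]
  by (intro analytic_intros) (use assms disc_factor_nonzero[of a] in auto)

lemma blaschke_factor_has_derivative:
  assumes "cmod a < 1" "cmod z = 1"
  shows "(blaschke_factor a has_field_derivative
           blaschke_factor a z * (phase_speed a z / z)) (at z)"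
proof (cases "a = 0")
  case True
  have "z \<noteq> 0" using assms by auto
  with True show ?thesis
    by (auto simp: blaschke_factor_def[abs_def] phase_speed_def intro!: derivative_eq_intros)
next
  case False
  have nz: "z \<noteq> 0" "z - a \<noteq> 0" "1 - cnj a * z \<noteq> 0" "of_real (cmod a) \<noteq> (0 :: complex)"
    using assms False disc_factor_nonzero[of a z] by auto
  define u where "u = a / of_real (cmod a)"
  have "((\<lambda>z. (a - z) / (1 - cnj a * z)) has_field_derivative
      ((0 - 1) * (1 - cnj a * z) - (a - z) * (0 - cnj a * 1)) / ((1 - cnj a * z) * (1 - cnj a * z))) (at z)"
    by (intro DERIV_divide DERIV_diff DERIV_const DERIV_ident DERIV_cmult nz)
  hence "((\<lambda>z. u * ((a - z) / (1 - cnj a * z))) has_field_derivative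
      u * (((0 - 1) * (1 - cnj a * z) - (a - z) * (0 - cnj a * 1)) / ((1 - cnj a * z) * (1 - cnj a * z)))) (at z)"
    by (rule DERIV_cmult)
  moreover have "(0 - 1) * (1 - cnj a * z) - (a - z) * (0 - cnj a * 1) = - of_real (1 - (cmod a)\<^sup>2)"
    by (simp add: complex_norm_square algebra_simps del: of_real_power)
  moreover have "u * (- of_real (1 - (cmod a)\<^sup>2) / ((1 - cnj a * z) * (1 - cnj a * z)))
      = u * ((a - z) / (1 - cnj a * z)) * (phase_speed a z / z)"
  proof -
    have "- k / (d * d) = (a - z) / d * (k * z / ((z - a) * d) / z)" if "d \<noteq> 0" for k d :: complex
      using that nz by (simp add: divide_simps) (simp add: algebra_simps)
    from this[OF nz(3), of "of_real (1 - (cmod a)\<^sup>2)"] show ?thesis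
      unfolding phase_speed_def mult.assoc by (simp only:)
  qed
  moreover have "blaschke_factor a = (\<lambda>z. u * ((a - z) / (1 - cnj a * z)))"
    using False by (simp add: blaschke_factor_def u_def fun_eq_iff)
  ultimately show ?thesis by (simp only:)
qed

text \<open>The sum is a rational function without poles on the circle. If it took the value \<open>c\<close> infinitely
often on this compact set, it would be constant by analytic continuation. But the part coming from the nonzero \<open>a j\<close>
vanishes at the origin and is positive on the circle.\<close>
lemma finite_phase_speed_levels:
  assumes "finite J" and a: "\<And>j. j \<in> J \<Longrightarrow> cmod (a j) < 1" and J: "\<exists>j\<in>J. a j \<noteq> 0"
  shows "finite {z. cmod z = 1 \<and> (\<Sum>j\<in>J. phase_speed (a j) z) = c}"
proof -
  define J1 where "J1 = {j \<in> J. a j \<noteq> 0}"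
  define n where "n = card (J - J1)"
  have J1: "finite J1" "J1 \<noteq> {}" using assms by (auto simp: J1_def)
  \<comment> \<open>The zero parameters contribute the constant \<open>n\<close> on the circle but the value \<open>0 / 0 = 0\<close> at the
      origin, so they are split off before continuing analytically.\<close>
  define G where "G = (\<lambda>z. (\<Sum>j\<in>J1. phase_speed (a j) z))"
  define T where "T = a ` J1 \<union> (\<lambda>j. 1 / cnj (a j)) ` J1"
  have T: "finite T" using J1 by (simp add: T_def)
  have Tnz: "z - a j \<noteq> 0" "1 - cnj (a j) * z \<noteq> 0" if "z \<in> - T" "j \<in> J1" for z j
    using that by (auto simp: T_def J1_def image_iff) (metis eq_divide_imp mult.commute complex_cnj_zero_iff)
  have split: "(\<Sum>j\<in>J. phase_speed (a j) z) = of_nat n + G z" if "cmod z = 1" for z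
  proof -
    have "z \<noteq> 0" using that by auto
    hence "(\<Sum>j\<in>J-J1. phase_speed (a j) z) = (\<Sum>j\<in>J-J1. 1)"
      by (intro sum.cong) (auto simp: J1_def phase_speed_def)
    moreover have "(\<Sum>j\<in>J. phase_speed (a j) z) = (\<Sum>j\<in>J-J1. phase_speed (a j) z) + G z"
      unfolding G_def by (rule sum.subset_diff) (auto simp: J1_def \<open>finite J\<close>)
    ultimately show ?thesis by (simp add: n_def)
  qed
  have circ: "sphere 0 1 \<subseteq> - T"
  proof
    fix z assume "z \<in> sphere (0::complex) 1"
    hence z: "cmod z = 1" by simp
    have "cmod (1 / cnj (a j)) > 1" if "j \<in> J1" for j
      using that a[of j] by (auto simp: J1_def norm_divide)
    with z a show "z \<in> - T" unfolding T_def J1_def by force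
  qed
  have holG: "(\<lambda>z. of_nat n + G z - c) holomorphic_on - T"
    unfolding G_def phase_speed_def using Tnz by (intro holomorphic_intros) auto
  \<comment> \<open>\<open>G\<close> is not constant, since it vanishes at \<open>0\<close> and is positive at the point \<open>1\<close> of the circle.\<close>
  have zero: "0 \<in> - T" by (auto simp: T_def J1_def)
  have "G 0 = 0" by (simp add: G_def phase_speed_def)
  have one: "(1::complex) \<in> - T" by (rule subsetD[OF circ]) simp
  have "Re (G 1) > 0"
    unfolding G_def Re_sum
  proof (intro sum_pos J1)
    fix j assume j: "j \<in> J1"
    hence "cmod (a j) < 1" "1 - a j \<noteq> 0" using a[of j] by (auto simp: J1_def)
    thus "Re (phase_speed (a j) 1) > 0"
      by (subst phase_speed_circle) (auto simp: abs_square_less_1)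
  qed
  hence "G 1 \<noteq> G 0" using \<open>G 0 = 0\<close> by auto
  hence "\<not> (\<lambda>z. of_nat n + G z - c) constant_on - T"
    using zero one unfolding constant_on_def by (metis (no_types, lifting) add_left_cancel diff_add_cancel)
  moreover have "connected (- T)"
    using connected_open_delete_finite[OF open_UNIV convex_connected[OF convex_UNIV] _ T] by (simp add: Compl_eq_Diff_UNIV)
  moreover have "open (- T)" using T by (simp add: finite_imp_closed open_Compl)
  ultimately have "finite {z \<in> sphere 0 1. of_nat n + G z - c = 0}"
    by (intro holomorphic_compact_finite_zeros[OF holG] circ) auto
  thus ?thesis
    by (rule rev_finite_subset) (auto simp: split)
qed

text \<open>The poles \<open>1 / cnj (a j)\<close> lie outside the closed disc, so the product is holomorphic in a larger disc
and its Taylor series converges absolutely on the unit circle.\<close>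
lemma blaschke_product_holomorphic:
  assumes "finite J" and a: "\<And>j. j \<in> J \<Longrightarrow> cmod (a j) < 1"
  shows "\<exists>R>1. (\<lambda>z. \<Prod>j\<in>J. blaschke_factor (a j) z) holomorphic_on ball 0 R"
proof -
  define M where "M = Max (insert (1/2) ((\<lambda>j. cmod (a j)) ` J))"
  have aM: "cmod (a j) \<le> M" if "j \<in> J" for j
    using that \<open>finite J\<close> unfolding M_def by (intro Max_ge) auto
  have M: "M < 1" "M > 0"
    using \<open>finite J\<close> a unfolding M_def by (auto simp: Max_gr_iff)
  have nz: "1 - cnj (a j) * z \<noteq> 0" if "j \<in> J" "z \<in> ball 0 (1 / M)" for j z
  proof -
    have "cmod (cnj (a j) * z) \<le> M * cmod z"
      using aM[OF that(1)] by (simp add: norm_mult mult_right_mono)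
    also have "\<dots> < 1" using that(2) M by (simp add: field_simps)
    finally show ?thesis by (metis eq_iff_diff_eq_0 norm_one less_irrefl)
  qed
  have "blaschke_factor (a j) holomorphic_on ball 0 (1 / M)" if "j \<in> J" for j
    unfolding blaschke_factor_def[abs_def] using nz[OF that]
    by (cases "a j = 0") (auto intro!: holomorphic_intros)
  hence "(\<lambda>z. \<Prod>j\<in>J. blaschke_factor (a j) z) holomorphic_on ball 0 (1 / M)"
    by (intro holomorphic_on_prod)
  thus ?thesis using M by (intro exI[of _ "1 / M"]) auto
qed

section \<open>Uniform decay of the coefficients of powers\<close>

text \<open>The uniformity in \<open>n\<close> is the point of the argument: \<open>n\<close> enters the estimate of
\<open>oscillatory_integral_bound\<close> only through the level \<open>\<theta> = n / k\<close>, and \<open>\<epsilon>\<close> can be chosen before \<open>\<theta>\<close>.\<close>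
lemma blaschke_power_coeffs_uniformly_small:
  assumes "finite J" and a: "\<And>j. j \<in> J \<Longrightarrow> cmod (a j) < 1" and J: "\<exists>j\<in>J. a j \<noteq> 0"
    and "\<delta> > 0"
  shows "\<exists>N. \<forall>k\<ge>N. \<forall>n.
           cmod (taylor_coeff (\<lambda>z. (\<Prod>j\<in>J. blaschke_factor (a j) z) ^ k) n) \<le> \<delta>"
proof -
  define Q where "Q = (\<lambda>z. \<Prod>j\<in>J. blaschke_factor (a j) z)"
  define H where "H = (\<lambda>z. \<Sum>j\<in>J. phase_speed (a j) z)"
  define p where "p = (\<lambda>t. Re (H (cis t)))"
  define p' where "p' = (\<lambda>t. Re (\<i> * cis t * deriv H (cis t)))"
  have Hp: "H (cis t) = of_real (p t)" for t
  proof -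
    have "H (cis t) = of_real (\<Sum>j\<in>J. (1 - (cmod (a j))\<^sup>2) / (cmod (cis t - a j))\<^sup>2)"
      unfolding H_def of_real_sum by (intro sum.cong refl phase_speed_circle a) auto
    thus ?thesis by (simp add: p_def)
  qed
  have H: "H analytic_on sphere 0 1"
    unfolding H_def by (intro analytic_on_sum phase_speed_analytic a)
  have dcis: "(cis has_vector_derivative \<i> * cis t) (at t)" for t
    using has_derivative_cis[OF has_derivative_ident, of t UNIV]
    by (simp add: has_vector_derivative_def)
  have dp: "(p has_real_derivative p' t) (at t)" for t
  proof -
    have "(H has_field_derivative deriv H (cis t)) (at (cis t))"
      using analytic_on_imp_differentiable_at[OF H] by (intro field_differentiable_derivI) auto
    from field_vector_diff_chain_at[OF dcis this]
    have "((\<lambda>t. H (cis t)) has_vector_derivative \<i> * cis t * deriv H (cis t)) (at t)"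
      by (simp add: o_def)
    from bounded_linear.has_vector_derivative[OF bounded_linear_Re this]
    show ?thesis
      by (simp add: p_def p'_def has_real_derivative_iff_has_vector_derivative)
  qed
  have cp': "continuous_on {0..2*pi} p'"
    unfolding p'_def
    by (intro continuous_intros continuous_on_compose2[OF holomorphic_on_imp_continuous_on
          [OF analytic_imp_holomorphic[OF analytic_deriv[OF H]]]]) auto
  have cp: "continuous_on {0..2*pi} p"
    by (intro continuous_at_imp_continuous_on ballI DERIV_isCont[OF dp])
  obtain M where M: "\<And>t. t \<in> {0..2*pi} \<Longrightarrow> \<bar>p' t\<bar> \<le> M"
    using compact_imp_bounded[OF compact_continuous_image[OF cp' compact_Icc]]
    unfolding bounded_iff real_norm_def by blast
  have levels: "finite {t \<in> {0..2*pi}. p t = c}" for c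
  proof -
    define Z where "Z = {z. cmod z = 1 \<and> H z = of_real c}"
    have "finite Z" unfolding Z_def H_def by (rule finite_phase_speed_levels[OF assms(1-3)])
    moreover have "inj_on cis {0..<2*pi}"
    proof (rule inj_onI)
      fix s t assume st: "s \<in> {0..<2*pi}" "t \<in> {0..<2*pi}" "cis s = cis t"
      hence "sin s = sin t \<and> cos s = cos t" by (simp add: complex_eq_iff)
      then obtain n :: int where n: "s = t + 2 * pi * n" unfolding sin_cos_eq_iff by blast
      have "\<bar>2 * pi * n\<bar> < 2 * pi * 1" using st n by auto
      hence "\<bar>real_of_int n\<bar> < 1" by (simp add: abs_mult)
      thus "s = t" using n by simp
    qed
    ultimately have "finite (insert (2*pi) (cis -` Z \<inter> {0..<2*pi}))"
      by (simp add: finite_vimage_IntI)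
    thus ?thesis
      by (rule rev_finite_subset) (auto simp: Z_def Hp)
  qed
  obtain \<epsilon> where "\<epsilon> > 0"
    and \<epsilon>: "\<And>\<theta>. integral {0..2*pi} (\<lambda>t. \<epsilon> / ((p t - \<theta>)\<^sup>2 + \<epsilon>)) \<le> pi * \<delta>"
    using uniformly_small_mass_near_levels[OF cp levels, of "pi * \<delta>"] \<open>\<delta> > 0\<close> by auto
  \<comment> \<open>Of the total \<open>2 * pi * \<delta>\<close>, one half is spent on \<open>\<epsilon>\<close> and the other half on the term \<open>2 * pi * M / (k * \<epsilon>)\<close>.\<close>
  define N where "N = Suc (nat \<lceil>2 * M / (\<epsilon> * \<delta>)\<rceil>)"
  obtain R where R: "R > 1" "Q holomorphic_on ball 0 R"
    using blaschke_product_holomorphic[of J a] assms(1,2) unfolding Q_def by blast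
  have nQ: "cmod (Q (cis t)) = 1" for t
    unfolding Q_def prod_norm[symmetric]
    by (intro prod.neutral ballI norm_blaschke_factor_circle a) auto
  have dQ: "((\<lambda>t. Q (cis t)) has_vector_derivative \<i> * of_real (p t) * Q (cis t)) (at t)" for t
  proof -
    have nz: "blaschke_factor (a j) (cis t) \<noteq> 0" if "j \<in> J" for j
      using norm_blaschke_factor_circle[OF a[OF that], of "cis t"] by auto
    have "(Q has_field_derivative Q (cis t) * (\<Sum>j\<in>J. blaschke_factor (a j) (cis t) *
        (phase_speed (a j) (cis t) / cis t) / blaschke_factor (a j) (cis t))) (at (cis t))"
      unfolding Q_def using nz
      by (intro has_field_derivative_prod' blaschke_factor_has_derivative a) auto
    also have "(\<Sum>j\<in>J. blaschke_factor (a j) (cis t) *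
        (phase_speed (a j) (cis t) / cis t) / blaschke_factor (a j) (cis t)) = H (cis t) / cis t"
      unfolding H_def sum_divide_distrib using nz by (intro sum.cong) auto
    finally have "(Q has_field_derivative Q (cis t) * (H (cis t) / cis t)) (at (cis t))" .
    from field_vector_diff_chain_at[OF dcis this]
    show ?thesis by (simp add: o_def Hp mult_ac)
  qed
  have "cmod (taylor_coeff (\<lambda>z. Q z ^ k) n) \<le> \<delta>" if k: "k \<ge> N" for k n
  proof -
    have k0: "real k > 0" using k by (simp add: N_def)
    \<comment> \<open>The phase of \<open>f\<close> has derivative \<open>k * p t - n\<close>, that is, frequency \<open>k\<close> and level \<open>n / k\<close>.\<close>
    define f where "f = (\<lambda>t. Q (cis t) ^ k * cis (- (real n * t)))"
    have df: "(f has_vector_derivative \<i> * of_real (real k * (p t - real n / real k)) * f t) (at t)" for t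
    proof -
      have "((\<lambda>w. w ^ k) has_field_derivative of_nat k * Q (cis t) ^ (k - 1)) (at (Q (cis t)))"
        by (auto intro!: derivative_eq_intros)
      from field_vector_diff_chain_at[OF dQ this]
      have "((\<lambda>t. Q (cis t) ^ k) has_vector_derivative
          \<i> * of_real (p t) * Q (cis t) * (of_nat k * Q (cis t) ^ (k - 1))) (at t)"
        by (simp add: o_def)
      also have "\<i> * of_real (p t) * Q (cis t) * (of_nat k * Q (cis t) ^ (k - 1))
          = \<i> * of_real (real k * p t) * Q (cis t) ^ k"
        using k0 by (cases k) (auto simp: mult_ac)
      finally have dQk: "((\<lambda>t. Q (cis t) ^ k) has_vector_derivative
          \<i> * of_real (real k * p t) * Q (cis t) ^ k) (at t)" .
      have "((\<lambda>t. cis (- (real n * t))) has_vector_derivative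
          - (\<i> * of_real (real n) * cis (- (real n * t)))) (at t)"
        unfolding has_vector_derivative_def
        by (auto intro!: derivative_eq_intros simp: scaleR_conv_of_real fun_eq_iff)
      with dQk have "(f has_vector_derivative 
          Q (cis t) ^ k * (- (\<i> * of_real (real n) * cis (- (real n * t))))
          + \<i> * of_real (real k * p t) * Q (cis t) ^ k * cis (- (real n * t))) (at t)"
        unfolding f_def by (rule has_vector_derivative_mult)
      moreover have "real k * (p t - real n / real k) = real k * p t - real n"
        using k0 by (simp add: field_simps)
      ultimately show ?thesis by (simp add: f_def algebra_simps)
    qed
    have "cmod (integral {0..2*pi} f) \<le> M * (2 * pi - 0) / (real k * \<epsilon>) +
        integral {0..2*pi} (\<lambda>t. \<epsilon> / ((p t - real n / real k)\<^sup>2 + \<epsilon>))"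
    proof (rule oscillatory_integral_bound[OF _ k0 \<open>\<epsilon> > 0\<close> dp cp' M df])
      show "cmod (f t) = 1" for t by (simp add: f_def norm_mult norm_power nQ)
      show "p (2 * pi) = p 0" by (simp add: p_def)
      have "cis (- (real n * (2 * pi))) = 1"
        using cis_multiple_2pi[of "- real n"] by (simp add: mult_ac)
      thus "f (2 * pi) = f 0" by (simp add: f_def)
    qed auto
    also have "\<dots> \<le> pi * \<delta> + pi * \<delta>"
    proof (intro add_mono \<epsilon>)
      have "2 * M / (\<epsilon> * \<delta>) \<le> real k" using k unfolding N_def by linarith
      hence "2 * M \<le> real k * (\<epsilon> * \<delta>)" using \<open>\<epsilon> > 0\<close> \<open>\<delta> > 0\<close> by (simp add: field_simps)
      hence "pi * (2 * M) \<le> pi * (real k * (\<epsilon> * \<delta>))" by (rule mult_left_mono) simp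
      thus "M * (2 * pi - 0) / (real k * \<epsilon>) \<le> pi * \<delta>"
        using k0 \<open>\<epsilon> > 0\<close> by (simp add: field_simps)
    qed
    also have "integral {0..2*pi} f = 2 * pi * taylor_coeff (\<lambda>z. Q z ^ k) n"
      unfolding f_def using taylor_coeff_eq_circle_integral[OF holomorphic_on_power[OF R(2)] R(1)]
      by (rule integral_unique)
    finally show ?thesis by (simp add: norm_mult)
  qed
  thus ?thesis unfolding Q_def by blast
qed

section \<open>Orlicz norms of coefficient sequences with unit square sum\<close>

lemma orlicz_norm_le:
  assumes "r > 0" and sums: "(\<lambda>j. (cmod (taylor_coeff f j))\<^sup>2) sums 1"
    and le: "\<And>j. \<phi> (cmod (taylor_coeff f j) / r) \<le> (cmod (taylor_coeff f j))\<^sup>2"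
  shows "orlicz_norm \<phi> f \<le> ennreal r"
proof -
  have "(\<Sum>j. ennreal (\<phi> (cmod (taylor_coeff f j) / r)))
      \<le> (\<Sum>j. ennreal ((cmod (taylor_coeff f j))\<^sup>2))"
    by (intro suminf_le ennreal_leI le) auto
  also have "\<dots> = ennreal 1"
    using sums by (intro suminf_ennreal_eq) auto
  finally show ?thesis
    unfolding orlicz_norm_def using \<open>r > 0\<close> by (intro Inf_lower) auto
qed

text \<open>By monotonicity of \<open>\<phi>\<close> the hypothesis at \<open>r\<close> passes to every smaller scale, where the sum then is at
least \<open>K > 1\<close>; so no scale below \<open>r\<close> is admissible.\<close>
lemma orlicz_norm_ge:
  assumes \<phi>: "orlicz_function \<phi>" and "r > 0" "K > 1"
    and sums: "(\<lambda>j. (cmod (taylor_coeff f j))\<^sup>2) sums 1"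
    and ge: "\<And>j. K * (cmod (taylor_coeff f j))\<^sup>2 \<le> \<phi> (cmod (taylor_coeff f j) / r)"
  shows "ennreal r \<le> orlicz_norm \<phi> f"
  unfolding orlicz_norm_def
proof (rule Inf_greatest, clarify)
  fix s :: real
  assume "s > 0" and s: "(\<Sum>j. ennreal (\<phi> (cmod (taylor_coeff f j) / s))) \<le> 1"
  have "r \<le> s"
  proof (rule ccontr)
    assume "\<not> r \<le> s"
    have "K * (cmod (taylor_coeff f j))\<^sup>2 \<le> \<phi> (cmod (taylor_coeff f j) / s)" for j
    proof -
      have "\<phi> (cmod (taylor_coeff f j) / r) \<le> \<phi> (cmod (taylor_coeff f j) / s)"
      proof (rule mono_onD[of "{0..}" \<phi>])
        show "mono_on {0..} \<phi>" using \<phi> by (simp add: orlicz_function_def)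
        show "cmod (taylor_coeff f j) / r \<le> cmod (taylor_coeff f j) / s"
          using \<open>s > 0\<close> \<open>\<not> r \<le> s\<close> by (intro divide_left_mono) auto
      qed (use \<open>r > 0\<close> \<open>s > 0\<close> in auto)
      with ge[of j] show ?thesis by simp
    qed
    hence "(\<Sum>j. ennreal (K * (cmod (taylor_coeff f j))\<^sup>2)) \<le> 1"
      by (intro order.trans[OF suminf_le s] ennreal_leI) auto
    moreover have "(\<Sum>j. ennreal (K * (cmod (taylor_coeff f j))\<^sup>2)) = ennreal (K * 1)"
      using \<open>K > 1\<close> by (intro suminf_ennreal_eq sums_mult sums) auto
    ultimately show False using \<open>K > 1\<close> by simp
  qed
  thus "ennreal r \<le> ennreal s" by (rule ennreal_leI)
qed

lemma taylor_coeff_le_1: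
  assumes "(\<lambda>j. (cmod (taylor_coeff f j))\<^sup>2) sums 1"
  shows "cmod (taylor_coeff f j) \<le> 1"
proof -
  have "(\<Sum>i\<in>{j}. (cmod (taylor_coeff f i))\<^sup>2) \<le> (\<Sum>i. (cmod (taylor_coeff f i))\<^sup>2)"
    using assms by (intro sum_le_suminf) (auto simp: sums_iff)
  hence "(cmod (taylor_coeff f j))\<^sup>2 \<le> 1" using assms by (simp add: sums_iff)
  thus ?thesis by (simp add: abs_square_le_1)
qed

lemma orlicz_norm_square:
  assumes \<phi>: "orlicz_function \<phi>" "\<And>t. t \<ge> 0 \<Longrightarrow> \<phi> t = t\<^sup>2"
    and sums: "(\<lambda>j. (cmod (taylor_coeff f j))\<^sup>2) sums 1"
  shows "orlicz_norm \<phi> f = 1"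
proof (rule antisym)
  show le: "orlicz_norm \<phi> f \<le> 1"
    using orlicz_norm_le[of 1 f \<phi>] sums \<phi> by simp
  show "1 \<le> orlicz_norm \<phi> f"
  proof (rule ccontr)
    assume "\<not> 1 \<le> orlicz_norm \<phi> f"
    then obtain x where x: "x \<ge> 0" "orlicz_norm \<phi> f = ennreal x" "x < 1"
      by (cases "orlicz_norm \<phi> f") (auto simp: not_le)
    define r where "r = (x + 1) / 2"
    have r: "x < r" "0 < r" "r < 1" using x by (auto simp: r_def)
    have "r\<^sup>2 < 1" using r by (simp add: abs_square_less_1)
    have "ennreal r \<le> orlicz_norm \<phi> f"
    proof (rule orlicz_norm_ge[OF \<phi>(1) r(2) _ sums])
      show "1 < 1 / r\<^sup>2" using \<open>r\<^sup>2 < 1\<close> r by simp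
    qed (use r in \<open>simp add: \<phi>(2) power_divide\<close>)
    with x r show False by simp
  qed
qed

text \<open>The comparison with \<open>t\<^sup>2\<close> is available only near \<open>0\<close>, whereas the coefficients are only known to lie in
the unit interval. For the upper bound the scale \<open>C\<close> is so large that all arguments fall below \<open>t0\<close>.
For the lower bound the scale \<open>r\<close> is small and the arguments \<open>x / r\<close> leave this range; convexity then carries
the estimate at \<open>s * x\<close> outwards, since \<open>\<phi> (s * x) \<le> r * s * \<phi> (x / r)\<close>.\<close>
lemma orlicz_norm_bounds_of_asymp_square:
  assumes \<phi>: "orlicz_function \<phi>" and asymp: "asymp_at_zero \<phi> (\<lambda>t. t\<^sup>2)"
  shows "\<exists>c>0. \<exists>C>0. \<forall>f. (\<lambda>j. (cmod (taylor_coeff f j))\<^sup>2) sums 1 \<longrightarrow>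
           ennreal c \<le> orlicz_norm \<phi> f \<and> orlicz_norm \<phi> f \<le> ennreal C"
proof -
  have \<phi>0: "\<phi> 0 = 0" and conv: "convex_on {0..} \<phi>" using \<phi> by (auto simp: orlicz_function_def)
  obtain A D t0 where "A > 0" "D > 0" and t0: "0 < t0" "t0 < 1"
    and le: "\<And>t. 0 < t \<Longrightarrow> t < t0 \<Longrightarrow> A * \<phi> t \<le> t\<^sup>2 \<and> t\<^sup>2 \<le> D * \<phi> t"
    using asymp unfolding asymp_at_zero_def by fastforce
  have lo: "t\<^sup>2 \<le> D * \<phi> t" and up: "A * \<phi> t \<le> t\<^sup>2" if "0 \<le> t" "t < t0" for t
    using le[of t] that \<phi>0 by (cases "t = 0"; simp)+
  define s where "s = t0 / 2"
  have s: "0 < s" "s < t0" "s < 1" using t0 by (auto simp: s_def)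
  define C where "C = 1 / s + 1 / A"
  have C: "C \<ge> 1" "C \<ge> 1 / A" "C > 0" "C \<ge> 1 / s"
  proof -
    have "1 / s \<ge> 1" "1 / A > 0" using s \<open>A > 0\<close> by auto
    thus "C \<ge> 1" "C \<ge> 1 / A" "C > 0" "C \<ge> 1 / s" unfolding C_def by linarith+
  qed
  have upper: "\<phi> (x / C) \<le> x\<^sup>2" if x: "0 \<le> x" "x \<le> 1" for x
  proof -
    have "x / C \<le> 1 / (1 / s)" using x C s by (intro frac_le) auto
    hence "x / C < t0" using s by simp
    hence "A * \<phi> (x / C) \<le> (x / C)\<^sup>2" using x C by (intro up) auto
    hence "\<phi> (x / C) \<le> (x / C)\<^sup>2 / A"
      using \<open>A > 0\<close> by (subst pos_le_divide_eq) (simp_all only: mult.commute)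
    also have "\<dots> = x\<^sup>2 / (A * C\<^sup>2)" by (simp add: power_divide)
    also have "\<dots> \<le> x\<^sup>2 / 1"
    proof (rule divide_left_mono)
      have "1 \<le> A * C" using C(2) \<open>A > 0\<close> by (simp add: field_simps)
      hence "1 * 1 \<le> A * C * C" using C(1) by (intro mult_mono) auto
      thus "1 \<le> A * C\<^sup>2" by (simp add: power2_eq_square mult_ac)
      thus "0 < A * C\<^sup>2 * 1" by simp
    qed simp
    finally show ?thesis by simp
  qed
  \<comment> \<open>The factor \<open>2\<close> leaves room above \<open>1\<close>; writing \<open>2 * D + 1\<close> also makes \<open>r * s \<le> 1\<close>, so that
      convexity applies to \<open>s * x = (r * s) * (x / r)\<close>.\<close>
  define r where "r = s / (2 * D + 1)"
  have r: "r > 0" "r * s \<le> 1"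
  proof -
    show "r > 0" using s \<open>D > 0\<close> by (simp add: r_def)
    have "s * s \<le> 1 * 1" using s by (intro mult_mono) auto
    thus "r * s \<le> 1" using \<open>D > 0\<close> by (simp add: r_def field_simps)
  qed
  have lower: "2 * x\<^sup>2 \<le> \<phi> (x / r)" if x: "0 \<le> x" "x \<le> 1" for x
  proof -
    have "\<phi> ((1 - r * s) *\<^sub>R 0 + (r * s) *\<^sub>R (x / r)) \<le> (1 - r * s) * \<phi> 0 + (r * s) * \<phi> (x / r)"
      using x r s by (intro convex_onD[OF conv]) auto
    hence "\<phi> (s * x) \<le> (r * s) * \<phi> (x / r)" using r \<phi>0 by simp
    moreover have "(s * x)\<^sup>2 \<le> D * \<phi> (s * x)"
      using x s mult_left_le[of x s] by (intro lo order.strict_trans1[OF _ s(2)]) auto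
    ultimately have "(s * x)\<^sup>2 \<le> D * ((r * s) * \<phi> (x / r))"
      using \<open>D > 0\<close> by (smt (verit) mult_left_mono)
    hence "s * (s * x\<^sup>2) \<le> s * (D * r * \<phi> (x / r))" by (simp add: power2_eq_square mult_ac)
    hence "s * x\<^sup>2 \<le> D * r * \<phi> (x / r)" using s by simp
    moreover have "s = r * (2 * D + 1)" using \<open>D > 0\<close> by (simp add: r_def)
    ultimately have "r * ((2 * D + 1) * x\<^sup>2) \<le> r * (D * \<phi> (x / r))" by (simp only: mult_ac)
    hence "(2 * D + 1) * x\<^sup>2 \<le> D * \<phi> (x / r)" by (rule mult_left_le_imp_le) (rule r(1))
    moreover have "2 * D * x\<^sup>2 \<le> (2 * D + 1) * x\<^sup>2" by (intro mult_right_mono) auto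
    ultimately have "D * (2 * x\<^sup>2) \<le> D * \<phi> (x / r)" by (simp add: mult_ac)
    thus ?thesis using \<open>D > 0\<close> by simp
  qed
  have "ennreal r \<le> orlicz_norm \<phi> f \<and> orlicz_norm \<phi> f \<le> ennreal C"
    if sums: "(\<lambda>j. (cmod (taylor_coeff f j))\<^sup>2) sums 1" for f
    using orlicz_norm_le[OF C(3) sums, of \<phi>] orlicz_norm_ge[OF \<phi> r(1) _ sums, of 2]
      upper lower taylor_coeff_le_1[OF sums] by auto
  with r C show ?thesis by blast
qed

text \<open>Once all arguments \<open>x / r\<close> lie where \<open>\<phi> t \<le> r\<^sup>2 * t\<^sup>2\<close>, the factor \<open>r\<^sup>2\<close> cancels the scale and the sum at
scale \<open>r\<close> is at most the sum of squares.\<close>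
lemma orlicz_norm_le_if_coeffs_small:
  assumes \<phi>: "orlicz_function \<phi>" and o: "\<phi> \<in> o[at_right 0](\<lambda>t. t\<^sup>2)" and "r > 0"
  shows "\<exists>\<delta>>0. \<forall>f. (\<lambda>j. (cmod (taylor_coeff f j))\<^sup>2) sums 1 \<and>
           (\<forall>j. cmod (taylor_coeff f j) \<le> \<delta>) \<longrightarrow> orlicz_norm \<phi> f \<le> ennreal r"
proof -
  have "eventually (\<lambda>t. norm (\<phi> t) \<le> r\<^sup>2 * norm (t\<^sup>2)) (at_right 0)"
    using \<open>r > 0\<close> by (intro landau_o.smallD[OF o]) simp
  then obtain t0 where t0: "t0 > 0" "\<And>t. 0 < t \<Longrightarrow> t < t0 \<Longrightarrow> \<bar>\<phi> t\<bar> \<le> r\<^sup>2 * t\<^sup>2"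
    unfolding eventually_at_right_field by auto
  have "\<phi> (x / r) \<le> x\<^sup>2" if "0 \<le> x" "x \<le> r * t0 / 2" for x
  proof (cases "x = 0")
    case False
    have "x / r < t0"
    proof -
      have "x < r * t0" using that \<open>r > 0\<close> t0(1) by (smt (verit) field_sum_of_halves mult_pos_pos)
      thus ?thesis using \<open>r > 0\<close> by (simp add: field_simps)
    qed
    hence "\<bar>\<phi> (x / r)\<bar> \<le> r\<^sup>2 * (x / r)\<^sup>2" using False that \<open>r > 0\<close> by (intro t0) auto
    thus ?thesis using \<open>r > 0\<close> by (simp add: power_divide)
  qed (use \<phi> in \<open>simp add: orlicz_function_def\<close>)
  thus ?thesis using \<open>r > 0\<close> t0(1)
    by (intro exI[of _ "r * t0 / 2"]) (auto intro!: orlicz_norm_le)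
qed

lemma orlicz_norm_ge_if_coeffs_small:
  assumes \<phi>: "orlicz_function \<phi>" and o: "(\<lambda>t. t\<^sup>2) \<in> o[at_right 0](\<phi>)" and "r > 0"
  shows "\<exists>\<delta>>0. \<forall>f. (\<lambda>j. (cmod (taylor_coeff f j))\<^sup>2) sums 1 \<and>
           (\<forall>j. cmod (taylor_coeff f j) \<le> \<delta>) \<longrightarrow> ennreal r \<le> orlicz_norm \<phi> f"
proof -
  have nonneg: "\<phi> t \<ge> 0" if "t \<ge> 0" for t using \<phi> that by (simp add: orlicz_function_def)
  define e where "e = 1 / (2 * r\<^sup>2)"
  have e: "e > 0" using \<open>r > 0\<close> by (simp add: e_def)
  have "eventually (\<lambda>t. norm (t\<^sup>2) \<le> e * norm (\<phi> t)) (at_right 0)"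
    using e by (intro landau_o.smallD[OF o])
  then obtain t0 where t0: "t0 > 0" "\<And>t. 0 < t \<Longrightarrow> t < t0 \<Longrightarrow> t\<^sup>2 \<le> e * \<bar>\<phi> t\<bar>"
    unfolding eventually_at_right_field by auto
  have "2 * x\<^sup>2 \<le> \<phi> (x / r)" if "0 \<le> x" "x \<le> r * t0 / 2" for x
  proof (cases "x = 0")
    case False
    have "x / r < t0"
    proof -
      have "x < r * t0" using that \<open>r > 0\<close> t0(1) by (smt (verit) field_sum_of_halves mult_pos_pos)
      thus ?thesis using \<open>r > 0\<close> by (simp add: field_simps)
    qed
    hence "(x / r)\<^sup>2 \<le> e * \<bar>\<phi> (x / r)\<bar>" using False that \<open>r > 0\<close> by (intro t0) auto
    also have "\<bar>\<phi> (x / r)\<bar> = \<phi> (x / r)" using nonneg that \<open>r > 0\<close> by simp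
    finally show ?thesis using \<open>r > 0\<close> by (simp add: e_def power_divide field_simps)
  qed (use \<phi> in \<open>simp add: orlicz_function_def\<close>)
  thus ?thesis using \<open>r > 0\<close> t0(1)
    by (intro exI[of _ "r * t0 / 2"]) (auto intro!: orlicz_norm_ge[OF \<phi>, of _ 2])
qed

section \<open>Orlicz norms of powers of a finite Blaschke product\<close>

theorem theorem1p2:
  fixes B :: "complex \<Rightarrow> complex" and \<phi> :: "real \<Rightarrow> real"
  assumes "finite_blaschke_product B"
    and "\<not> power_of_z B"
    and "orlicz_function \<phi>"
  shows
    "(asymp_at_zero \<phi> (\<lambda>t. t\<^sup>2) \<longrightarrow>
        (\<exists>c C :: real. c > 0 \<and> C > 0 \<and>
          (\<forall>k::nat. ennreal c \<le> orlicz_norm \<phi> (\<lambda>z. B z ^ k) \<and>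
                    orlicz_norm \<phi> (\<lambda>z. B z ^ k) \<le> ennreal C)))
     \<and> ((\<forall>t\<ge>0. \<phi> t = t\<^sup>2) \<longrightarrow> (\<forall>k::nat. orlicz_norm \<phi> (\<lambda>z. B z ^ k) = 1))
     \<and> (\<phi> \<in> o[at_right 0](\<lambda>t. t\<^sup>2) \<longrightarrow>
        (\<lambda>k::nat. orlicz_norm \<phi> (\<lambda>z. B z ^ k)) \<longlonglongrightarrow> 0)
     \<and> ((\<lambda>t. t\<^sup>2) \<in> o[at_right 0](\<phi>) \<longrightarrow>
        (\<lambda>k::nat. orlicz_norm \<phi> (\<lambda>z. B z ^ k)) \<longlonglongrightarrow> \<infinity>)"
proof -
  obtain m :: nat and a where am: "\<forall>j\<in>{1..m}. a j \<in> ball 0 1"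
    and B: "\<And>z. z \<in> ball 0 1 \<Longrightarrow> B z = (\<Prod>j=1..m. blaschke_factor (a j) z)"
    using assms(1) unfolding finite_blaschke_product_def by blast
  have a: "cmod (a j) < 1" if "j \<in> {1..m}" for j
    using am that by auto
  define Q where "Q = (\<lambda>z. \<Prod>j=1..m. blaschke_factor (a j) z)"
  have nz: "\<exists>j\<in>{1..m}. a j \<noteq> 0"
  proof (rule ccontr)
    assume "\<not> ?thesis"
    hence "(\<Prod>j=1..m. blaschke_factor (a j) z) = (\<Prod>j=1..m. z)" for z
      by (intro prod.cong) (auto simp: blaschke_factor_def)
    hence "power_of_z B" using B unfolding power_of_z_def by (intro exI[of _ m]) simp
    with assms(2) show False ..
  qed
  have coeff: "taylor_coeff (\<lambda>z. B z ^ k) = taylor_coeff (\<lambda>z. Q z ^ k)" for k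
  proof -
    have "eventually (\<lambda>z. z \<in> ball 0 1) (nhds (0::complex))"
      by (intro eventually_nhds_in_open) auto
    hence "eventually (\<lambda>z. B z ^ k = Q z ^ k) (nhds 0)"
      by eventually_elim (simp add: B Q_def)
    thus ?thesis unfolding taylor_coeff_def[abs_def] by (simp add: fps_expansion_cong)
  qed
  obtain R where R: "R > 1" "Q holomorphic_on ball 0 R"
    using blaschke_product_holomorphic[of "{1..m}" a] a unfolding Q_def by blast
  have sums: "(\<lambda>j. (cmod (taylor_coeff (\<lambda>z. B z ^ k) j))\<^sup>2) sums 1" for k
  proof -
    have "cmod (Q (cis t)) = 1" for t
      unfolding Q_def prod_norm[symmetric]
      by (intro prod.neutral ballI norm_blaschke_factor_circle a) auto
    thus ?thesis
      using parseval_circle[OF holomorphic_on_power[OF R(2), of k] R(1)]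
      by (simp add: coeff norm_power)
  qed
  have small: "\<exists>N. \<forall>k\<ge>N. \<forall>j. cmod (taylor_coeff (\<lambda>z. B z ^ k) j) \<le> \<delta>" if "\<delta> > 0" for \<delta>
    using blaschke_power_coeffs_uniformly_small[OF _ _ nz that] a unfolding coeff Q_def by simp
  show ?thesis
  proof (intro conjI impI)
    assume "asymp_at_zero \<phi> (\<lambda>t. t\<^sup>2)"
    from orlicz_norm_bounds_of_asymp_square[OF assms(3) this]
    show "\<exists>c C :: real. c > 0 \<and> C > 0 \<and> (\<forall>k. ennreal c \<le> orlicz_norm \<phi> (\<lambda>z. B z ^ k) \<and>
                    orlicz_norm \<phi> (\<lambda>z. B z ^ k) \<le> ennreal C)"
      using sums by blast
  next
    assume "\<forall>t\<ge>0. \<phi> t = t\<^sup>2"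
    thus "\<forall>k. orlicz_norm \<phi> (\<lambda>z. B z ^ k) = 1"
      using orlicz_norm_square[OF assms(3) _ sums] by blast
  next
    assume o: "\<phi> \<in> o[at_right 0](\<lambda>t. t\<^sup>2)"
    show "(\<lambda>k. orlicz_norm \<phi> (\<lambda>z. B z ^ k)) \<longlonglongrightarrow> 0"
    proof (rule order_tendstoI)
      fix y :: ennreal assume "0 < y"
      then obtain x where x: "0 < x" "x < y" using dense by blast
      then obtain r where r: "0 < r" "ennreal r < y" by (cases x) auto
      obtain \<delta> where "\<delta> > 0" and \<delta>: "\<And>f. (\<lambda>j. (cmod (taylor_coeff f j))\<^sup>2) sums 1 \<Longrightarrow>
           (\<forall>j. cmod (taylor_coeff f j) \<le> \<delta>) \<Longrightarrow> orlicz_norm \<phi> f \<le> ennreal r"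
        using orlicz_norm_le_if_coeffs_small[OF assms(3) o r(1)] by blast
      obtain N where N: "\<And>k. k \<ge> N \<Longrightarrow> \<forall>j. cmod (taylor_coeff (\<lambda>z. B z ^ k) j) \<le> \<delta>"
        using small[OF \<open>\<delta> > 0\<close>] by blast
      show "eventually (\<lambda>k. orlicz_norm \<phi> (\<lambda>z. B z ^ k) < y) sequentially"
        using eventually_ge_at_top[of N]
        by eventually_elim (rule le_less_trans[OF \<delta>[OF sums N] r(2)])
    qed simp
  next
    assume o: "(\<lambda>t. t\<^sup>2) \<in> o[at_right 0](\<phi>)"
    show "(\<lambda>k. orlicz_norm \<phi> (\<lambda>z. B z ^ k)) \<longlonglongrightarrow> \<infinity>"
    proof (rule order_tendstoI)
      fix y :: ennreal assume y: "y < \<infinity>"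
      then obtain x where x: "x \<ge> 0" "y = ennreal x" by (cases y) auto
      define r where "r = x + 1"
      have r: "0 < r" "y < ennreal r" using x by (auto simp: r_def ennreal_less_iff)
      obtain \<delta> where "\<delta> > 0" and \<delta>: "\<And>f. (\<lambda>j. (cmod (taylor_coeff f j))\<^sup>2) sums 1 \<Longrightarrow>
           (\<forall>j. cmod (taylor_coeff f j) \<le> \<delta>) \<Longrightarrow> ennreal r \<le> orlicz_norm \<phi> f"
        using orlicz_norm_ge_if_coeffs_small[OF assms(3) o r(1)] by blast
      obtain N where N: "\<And>k. k \<ge> N \<Longrightarrow> \<forall>j. cmod (taylor_coeff (\<lambda>z. B z ^ k) j) \<le> \<delta>"
        using small[OF \<open>\<delta> > 0\<close>] by blast
      show "eventually (\<lambda>k. y < orlicz_norm \<phi> (\<lambda>z. B z ^ k)) sequentially"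
        using eventually_ge_at_top[of N]
        by eventually_elim (rule less_le_trans[OF r(2) \<delta>[OF sums N]])
    qed simp
  qed
qed

end
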